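(* Let $n\ge 1$ and let $P(z)$ be a polynomial of degree $n$ with complex coefficients. Let $a\in\mathbb{C}$ with $|a|\le 1$. Then for all $\alpha,\beta\in\mathbb{C}$ with $|\alpha|\le 1$, $|\beta|\le 1$, every real $R\ge 1$, and every $z\in\mathbb{C}$ with $|z|\ge 1$, $$\left|\tilde{\mathbb{S}}_a[P](Rz)-\alpha\,\tilde{\mathbb{S}}_a[P](z)+\beta\left\{\left(\tfrac{R+1}{2}\right)^n-|\alpha|\right\}\tilde{\mathbb{S}}_a[P](z)\right|\le \left|R^n-\alpha+\beta\left\{\left(\tfrac{R+1}{2}\right)^n-|\alpha|\right\}\right|\,\bigl|\tilde{\mathbb{S}}_a[z^n]\bigr|\,\max_{|\zeta|=1}|P(\zeta)|.$$ The result is sharp: equality holds for $P(z)=\lambda z^n$, $\lambda\in\mathbb{C}$, $\lambda\neq 0$.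
   Context: For a fixed integer $n\ge 1$, a number $a\in\mathbb{C}$ with $|a|\le 1$, and a polynomial $P$ of degree at most $n$, the modified Smirnov operator is $\tilde{\mathbb{S}}_a[P](z)=(1+az)P'(z)-naP(z)$. The symbol $\tilde{\mathbb{S}}_a[P](Rz)$ denotes the operator applied to the polynomial $z\mapsto P(Rz)$ and evaluated at $z$, i.e. $\tilde{\mathbb{S}}_a[P](Rz)=(1+az)\,R\,P'(Rz)-na\,P(Rz)$. The symbol $\tilde{\mathbb{S}}_a[z^n]$ denotes the operator applied to the monomial $z^n$, evaluated at $z$, i.e. $\tilde{\mathbb{S}}_a[z^n]=(1+az)nz^{n-1}-naz^n=nz^{n-1}$. *)

theory Defs
  imports "HOL-Analysis.Analysis" "HOL-Computational_Algebra.Polynomial"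
begin

text \<open>The parameter \<open>n\<close> is an upper bound for the degree of the argument, not necessarily
  its degree; the operator depends on it.\<close>

definition modified_smirnov :: "nat \<Rightarrow> complex \<Rightarrow> complex poly \<Rightarrow> complex \<Rightarrow> complex" where
  "modified_smirnov n a P z = (1 + a * z) * poly (pderiv P) z - of_nat n * a * poly P z"

definition dilate :: "real \<Rightarrow> complex poly \<Rightarrow> complex poly" where
  "dilate R P = P \<circ>\<^sub>p [:0, of_real R:]"

lemma poly_dilate: "poly (dilate R P) z = poly P (of_real R * z)"
  by (simp add: dilate_def poly_pcompose mult.commute)

text \<open>In the notation \<open>S[P](Rz)\<close> the operator acts on the dilated polynomial, so that a
  factor \<open>R\<close> appears and the coefficient is \<open>1 + a z\<close>, not \<open>1 + a R z\<close>.\<close>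

lemma modified_smirnov_dilate:
  "modified_smirnov n a (dilate R P) z =
     (1 + a * z) * of_real R * poly (pderiv P) (of_real R * z)
       - of_nat n * a * poly P (of_real R * z)"
  by (simp add: modified_smirnov_def dilate_def pderiv_pcompose poly_pcompose pderiv_pCons
      algebra_simps)

text \<open>\<open>Max\<close> is only meaningful on finite sets, hence the supremum; it is attained
  by compactness of the circle.\<close>

definition max_on_circle :: "complex poly \<Rightarrow> real" where
  "max_on_circle P = (SUP \<zeta>\<in>sphere 0 1. cmod (poly P \<zeta>))"

lemma max_on_circle_attained:
  "\<exists>\<zeta>\<in>sphere 0 1. max_on_circle P = cmod (poly P \<zeta>) \<and>
     (\<forall>w\<in>sphere 0 1. cmod (poly P w) \<le> cmod (poly P \<zeta>))"
proof -
  have "continuous_on (sphere 0 1) (\<lambda>w. cmod (poly P w))"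
    by (intro continuous_intros)
  moreover have "compact (sphere (0::complex) 1)" "sphere (0::complex) 1 \<noteq> {}"
    by simp_all
  ultimately obtain \<zeta> where \<zeta>: "\<zeta> \<in> sphere 0 1"
      "\<forall>w\<in>sphere 0 1. cmod (poly P w) \<le> cmod (poly P \<zeta>)"
    using continuous_attains_sup by meson
  then have "max_on_circle P = cmod (poly P \<zeta>)"
    unfolding max_on_circle_def by (intro cSup_eq_maximum) auto
  with \<zeta> show ?thesis by blast
qed

end

theory Submission
  imports Defs "HOL-Complex_Analysis.Conformal_Mappings"
    "HOL-Computational_Algebra.Fundamental_Theorem_Algebra"
begin

text \<open>If the bound failed at \<open>z\<close>, then, since both sides are linear in \<open>P\<close>, some constant
  \<open>\<mu>\<close> with \<open>\<bar>\<mu>\<bar> > max \<bar>P\<bar>\<close> would make the left-hand operator vanish at \<open>z\<close> on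
  \<open>F = \<mu> x\<^sup>n - P\<close>.  By the maximum principle all zeros of \<open>F\<close> lie in the open unit disk.
  Comparing linear factors, \<open>\<bar>F(Rx)\<bar> > ((R+1)/2)\<^sup>n \<bar>F(x)\<bar>\<close> for \<open>\<bar>x\<bar> \<ge> 1\<close>, \<open>R > 1\<close>, so
  \<open>F(Rx) - \<gamma> F(x)\<close> with \<open>\<bar>\<gamma>\<bar> \<le> ((R+1)/2)\<^sup>n\<close> again has degree \<open>n\<close> and all zeros in the open
  disk.  By Laguerre's theorem the Smirnov operator preserves the absence of zeros in
  \<open>\<bar>x\<bar> \<ge> 1\<close>, a contradiction.\<close>

section \<open>Growth under dilation of polynomials with all zeros in the open unit disk\<close>

lemma poly_linear_factorization:
  fixes p :: "complex poly"
  obtains r where "p = smult (lead_coeff p) (\<Prod>i<degree p. [:- r i, 1:])"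
    and "\<And>x. poly p x = lead_coeff p * (\<Prod>i<degree p. x - r i)"
    and "\<And>i. i < degree p \<Longrightarrow> poly p (r i) = 0"
proof -
  obtain r where r: "smult (lead_coeff p) (\<Prod>i<degree p. [:- r i, 1:]) = p"
    by (rule complex_poly_decompose')
  have ev: "poly p x = lead_coeff p * (\<Prod>i<degree p. x - r i)" for x
    by (subst r[symmetric]) (simp add: poly_prod)
  have "poly p (r i) = 0" if "i < degree p" for i
    using that by (auto simp: ev)
  with r ev show thesis by (intro that) auto
qed

text \<open>After squaring, the difference of the two sides is
  \<open>((R - 1) / 2 * cmod (z + w))\<^sup>2\<close> plus a multiple of
  \<open>(cmod z)\<^sup>2 - (cmod w)\<^sup>2\<close> that is positive for
  \<open>R > 1\<close>.\<close>

lemma norm_linear_factor_dilate: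
  fixes z w :: complex
  assumes "R > 1" "cmod z \<ge> 1" "cmod w < 1"
  shows "cmod (of_real R * z - w) > (R + 1) / 2 * cmod (z - w)"
proof -
  have "(cmod w)\<^sup>2 < (cmod z)\<^sup>2"
    using assms by (intro power_strict_mono) auto
  hence "(R\<^sup>2 - 1) * ((cmod z)\<^sup>2 - (cmod w)\<^sup>2) > 0"
    using assms by simp
  moreover have "(cmod (of_real R * z - w))\<^sup>2 =
      ((R + 1) / 2 * cmod (z - w))\<^sup>2 + ((R - 1) / 2 * cmod (z + w))\<^sup>2
        + (R\<^sup>2 - 1) * ((cmod z)\<^sup>2 - (cmod w)\<^sup>2) / 2"
    unfolding power_mult_distrib cmod_power2 by (simp add: power2_eq_square field_simps)
  ultimately have "((R + 1) / 2 * cmod (z - w))\<^sup>2 < (cmod (of_real R * z - w))\<^sup>2"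
    by (smt (verit) zero_le_power2 half_gt_zero)
  thus ?thesis
    by (rule power2_less_imp_less) simp
qed

lemma norm_poly_dilate:
  fixes p :: "complex poly"
  assumes "R > 1" "cmod z \<ge> 1" "degree p \<ge> 1"
    and zeros: "\<And>x. cmod x \<ge> 1 \<Longrightarrow> poly p x \<noteq> 0"
  shows "cmod (poly p (of_real R * z)) > ((R + 1) / 2) ^ degree p * cmod (poly p z)"
proof -
  obtain r where ev: "\<And>x. poly p x = lead_coeff p * (\<Prod>i<degree p. x - r i)"
    and r: "\<And>i. i < degree p \<Longrightarrow> poly p (r i) = 0"
    using poly_linear_factorization[of p] by metis
  have r1: "cmod (r i) < 1" if "i < degree p" for i
    using r[OF that] zeros[of "r i"] by (meson not_le)
  have fac: "(R + 1) / 2 * cmod (z - r i) < cmod (of_real R * z - r i)" if "i < degree p" for i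
    using norm_linear_factor_dilate[OF assms(1,2) r1[OF that]] .
  have pos: "0 \<le> (R + 1) / 2 * cmod (z - r i)" for i
    using assms(1) by simp
  have lc: "cmod (lead_coeff p) > 0"
    using assms(3) by auto
  have "((R + 1) / 2) ^ degree p * (\<Prod>i<degree p. cmod (z - r i))
      = (\<Prod>i<degree p. (R + 1) / 2 * cmod (z - r i))"
    unfolding prod.distrib by simp
  also have "\<dots> < (\<Prod>i<degree p. cmod (of_real R * z - r i))"
  \<comment> \<open>Since the degree is positive, the factor with index 0 exists and supplies
    strictness; an empty product would only give equality.\<close>
  proof (rule prod_mono_strict[where i = 0])
    show "0 < cmod (of_real R * z - r i)" if "i \<in> {..<degree p}" for i
      using le_less_trans[OF pos fac] that by blast
  qed (use fac pos assms(3) in \<open>auto intro: less_imp_le\<close>)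
  finally have "((R + 1) / 2) ^ degree p * (\<Prod>i<degree p. cmod (z - r i))
      < (\<Prod>i<degree p. cmod (of_real R * z - r i))" .
  from mult_strict_left_mono[OF this lc] show ?thesis
    unfolding ev norm_mult prod_norm[symmetric] by (simp add: mult_ac)
qed

section \<open>Laguerre's theorem and its effect on the Smirnov operator\<close>

text \<open>Logarithmic derivative of a product of linear factors, multiplied out.\<close>

lemma pderiv_prod_linear:
  fixes r :: "nat \<Rightarrow> complex"
  assumes "\<And>i. i < n \<Longrightarrow> z \<noteq> r i"
  shows "poly (pderiv (\<Prod>i<n. [:- r i, 1:])) z
    = poly (\<Prod>i<n. [:- r i, 1:]) z * (\<Sum>i<n. 1 / (z - r i))"
  using assms
proof (induction n)
  case (Suc n)
  define q where "q = (\<Prod>i<n. [:- r i, 1:])"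
  have zn: "z - r n \<noteq> 0" using Suc.prems[of n] by simp
  have IH: "poly (pderiv q) z = poly q z * (\<Sum>i<n. 1 / (z - r i))"
    unfolding q_def using Suc by simp
  have "poly (pderiv (q * [:- r n, 1:])) z = poly q z + (z - r n) * poly (pderiv q) z"
    by (subst pderiv_mult) (simp add: pderiv_pCons algebra_simps)
  also have "\<dots> = (z - r n) * poly q z * ((\<Sum>i<n. 1 / (z - r i)) + 1 / (z - r n))"
    using zn by (simp add: IH field_simps)
  finally show ?case by (simp add: q_def[symmetric] algebra_simps)
qed simp

text \<open>For \<open>\<bar>z\<bar> \<ge> 1\<close> this set is the image of \<open>{w. \<bar>w\<bar> < 1}\<close> under \<open>w \<mapsto> 1 / (z - w)\<close>: a disk or
  a half-plane.\<close>

lemma convex_inversion_unit_disk: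
  fixes z :: complex
  assumes "cmod z \<ge> 1"
  shows "convex {u. cmod (z * u - 1) < cmod u}"
proof -
  define \<phi> where "\<phi> u = (cmod (z * u - 1))\<^sup>2 - (cmod u)\<^sup>2" for u
  have mem: "cmod (z * u - 1) < cmod u \<longleftrightarrow> \<phi> u < 0" for u
    by (auto simp: \<phi>_def intro: power_strict_mono power2_less_imp_less)
  show ?thesis
  proof (rule convexI)
    fix u v :: complex and s t :: real
    assume uv: "u \<in> {u. cmod (z * u - 1) < cmod u}" "v \<in> {u. cmod (z * u - 1) < cmod u}"
      and st: "0 \<le> s" "0 \<le> t" "s + t = 1"
    have t: "t = 1 - s" using st by simp
    \<comment> \<open>The quadratic part of \<open>\<phi>\<close> is
      \<open>((cmod z)\<^sup>2 - 1) * (cmod u)\<^sup>2\<close>, so \<open>\<phi>\<close> is convex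
      for \<open>cmod z \<ge> 1\<close>; the subtracted term is the exact convexity defect.\<close>
    have "\<phi> (s *\<^sub>R u + t *\<^sub>R v)
        = s * \<phi> u + t * \<phi> v - s * t * (((cmod z)\<^sup>2 - 1) * (cmod (u - v))\<^sup>2)"
      unfolding \<phi>_def cmod_power2 t by (simp add: power2_eq_square algebra_simps)
    moreover have "s * t * (((cmod z)\<^sup>2 - 1) * (cmod (u - v))\<^sup>2) \<ge> 0"
      using st assms by (intro mult_nonneg_nonneg) auto
    moreover have "s * \<phi> u + t * \<phi> v < 0"
    proof (cases "s = 0")
      case False
      hence "s * \<phi> u < 0" using uv st by (simp add: mem mult_pos_neg)
      moreover have "t * \<phi> v \<le> 0" using uv st by (simp add: mem mult_nonneg_nonpos)
      ultimately show ?thesis by simp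
    qed (use uv st in \<open>simp add: mem\<close>)
    ultimately show "s *\<^sub>R u + t *\<^sub>R v \<in> {u. cmod (z * u - 1) < cmod u}"
      by (simp add: mem)
  qed
qed

text \<open>The logarithmic derivative divided by the degree is the mean \<open>u\<close> of the
  numbers \<open>1 / (z - r i)\<close>. These lie in the convex image of the open disk under
  inversion, hence so does \<open>u\<close>, and \<open>w = z - 1 / u\<close> is its
  preimage.\<close>

lemma Laguerre_unit_disk:
  fixes p :: "complex poly"
  assumes "cmod z \<ge> 1" "degree p \<ge> 1"
    and zeros: "\<And>x. cmod x \<ge> 1 \<Longrightarrow> poly p x \<noteq> 0"
  obtains w where "cmod w < 1"
    and "(z - w) * poly (pderiv p) z = of_nat (degree p) * poly p z"
proof -
  define n where "n = degree p"
  obtain r where p: "p = smult (lead_coeff p) (\<Prod>i<n. [:- r i, 1:])"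
    and r: "\<And>i. i < n \<Longrightarrow> poly p (r i) = 0"
    unfolding n_def using poly_linear_factorization[of p] by metis
  have r1: "cmod (r i) < 1" if "i < n" for i
    using r[OF that] zeros[of "r i"] by (meson not_le)
  have zr: "z \<noteq> r i" if "i < n" for i
    using r1[OF that] assms(1) by auto
  define u where "u = (\<Sum>i<n. (1 / real n) *\<^sub>R (1 / (z - r i)))"
  have "u \<in> {u. cmod (z * u - 1) < cmod u}"
    unfolding u_def
  proof (rule convex_sum)
    show "convex {u. cmod (z * u - 1) < cmod u}"
      by (rule convex_inversion_unit_disk[OF assms(1)])
    fix i assume "i \<in> {..<n}"
    hence i: "i < n" by simp
    have "z * (1 / (z - r i)) - 1 = r i / (z - r i)"
      using zr[OF i] by (simp add: field_simps)
    moreover have "cmod (r i / (z - r i)) < cmod (1 / (z - r i))"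
      using zr[OF i] r1[OF i] by (simp add: norm_divide divide_strict_right_mono)
    ultimately show "1 / (z - r i) \<in> {u. cmod (z * u - 1) < cmod u}" by simp
  qed (use assms(2) in \<open>auto simp: n_def\<close>)
  hence u: "cmod (z * u - 1) < cmod u" by simp
  hence u0: "u \<noteq> 0" by auto
  have n0: "n > 0" using assms(2) by (simp add: n_def)
  have nu: "(\<Sum>i<n. 1 / (z - r i)) = of_nat n * u"
    using n0 by (simp add: u_def scaleR_conv_of_real sum_distrib_left)
  have "poly (pderiv p) z = poly p z * (\<Sum>i<n. 1 / (z - r i))"
    by (subst (1 2) p) (simp add: pderiv_smult pderiv_prod_linear[OF zr])
  hence "(1 / u) * poly (pderiv p) z = of_nat n * poly p z"
    using u0 by (simp add: nu)
  moreover have "cmod (z - 1 / u) < 1"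
  proof -
    have "z - 1 / u = (z * u - 1) / u" using u0 by (simp add: field_simps)
    thus ?thesis using u u0 by (simp add: norm_divide)
  qed
  ultimately show thesis
    by (intro that[of "z - 1 / u"]) (auto simp: n_def)
qed

text \<open>Laguerre's identity replaces \<open>n p(z)\<close> by \<open>(z - w) p'(z)\<close>, so
  the operator collapses to \<open>(1 + a w) p'(z)\<close> with \<open>cmod (a * w) < 1\<close>. The
  operator is indexed by the exact degree of \<open>p\<close> to match the factor in that
  identity.\<close>

lemma modified_smirnov_nonzero:
  fixes p :: "complex poly"
  assumes "cmod a \<le> 1" "cmod z \<ge> 1" "degree p \<ge> 1"
    and zeros: "\<And>x. cmod x \<ge> 1 \<Longrightarrow> poly p x \<noteq> 0"
  shows "modified_smirnov (degree p) a p z \<noteq> 0"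
proof -
  obtain w where w: "cmod w < 1"
      "(z - w) * poly (pderiv p) z = of_nat (degree p) * poly p z"
    by (rule Laguerre_unit_disk[OF assms(2-4)])
  have "modified_smirnov (degree p) a p z
      = (1 + a * z) * poly (pderiv p) z - a * ((z - w) * poly (pderiv p) z)"
    by (simp add: modified_smirnov_def w(2))
  also have "\<dots> = (1 + a * w) * poly (pderiv p) z"
    by (simp add: algebra_simps)
  finally have S: "modified_smirnov (degree p) a p z = (1 + a * w) * poly (pderiv p) z" .
  have "poly (pderiv p) z \<noteq> 0"
    using w(2) zeros[OF assms(2)] assms(3) by auto
  moreover have "1 + a * w \<noteq> 0"
  proof
    assume "1 + a * w = 0"
    hence "a * w = - 1" by (simp add: eq_neg_iff_add_eq_0 add.commute)
    hence "cmod (a * w) = 1" by simp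
    moreover have "cmod a * cmod w \<le> cmod w"
      using assms(1) by (intro mult_left_le_one_le) auto
    ultimately show False
      using w(1) by (simp add: norm_mult)
  qed
  ultimately show ?thesis by (simp add: S)
qed

section \<open>Maximum principle outside the disk; linearity and monomials\<close>

lemma norm_poly_le_max_on_circle: "cmod w = 1 \<Longrightarrow> cmod (poly P w) \<le> max_on_circle P"
  using max_on_circle_attained[of P] by auto

text \<open>Reflection turns the exterior of the disk into its interior: on the circle the modulus
  at \<open>z\<close> is that of \<open>P\<close> at \<open>inverse z\<close>, and the maximum
  principle does the rest.\<close>

lemma norm_reflect_poly_le:
  assumes "cmod w \<le> 1"
  shows "cmod (poly (reflect_poly P) w) \<le> max_on_circle P"
proof (rule maximum_modulus_frontier[of "poly (reflect_poly P)" "cball 0 1"])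
  fix z :: complex assume "z \<in> frontier (cball 0 1)"
  hence z: "cmod z = 1" by simp
  hence "z \<noteq> 0" by auto
  moreover have "cmod (poly P (inverse z)) \<le> max_on_circle P"
    using z by (intro norm_poly_le_max_on_circle) (simp add: norm_inverse)
  ultimately show "cmod (poly (reflect_poly P) z) \<le> max_on_circle P"
    using z by (simp add: poly_reflect_poly_nz norm_mult norm_power)
qed (use assms in \<open>auto intro!: holomorphic_intros continuous_intros\<close>)

lemma norm_poly_outside_disk:
  assumes "cmod z \<ge> 1"
  shows "cmod (poly P z) \<le> max_on_circle P * cmod z ^ degree P"
proof -
  have z: "z \<noteq> 0" using assms by auto
  have "cmod (poly (reflect_poly P) (inverse z)) \<le> max_on_circle P"
    using assms by (intro norm_reflect_poly_le) (simp add: norm_inverse inverse_le_1_iff)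
  thus ?thesis
    using z by (simp add: poly_reflect_poly_nz norm_mult norm_power norm_inverse norm_divide field_simps)
qed

text \<open>The leading coefficient is the value of the reflected polynomial at 0.\<close>

lemma norm_lead_coeff_le: "cmod (lead_coeff P) \<le> max_on_circle P"
  using norm_reflect_poly_le[of 0 P] by simp

lemma modified_smirnov_diff:
  "modified_smirnov n a (p - q) z = modified_smirnov n a p z - modified_smirnov n a q z"
  by (simp add: modified_smirnov_def pderiv_diff algebra_simps)

lemma modified_smirnov_smult:
  "modified_smirnov n a (smult c p) z = c * modified_smirnov n a p z"
  by (simp add: modified_smirnov_def pderiv_smult algebra_simps)

lemma modified_smirnov_monom:
  assumes "n \<ge> 1"
  shows "modified_smirnov n a (monom c n) z = c * of_nat n * z ^ (n - 1)"
proof -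
  \<comment> \<open>This makes the two terms containing \<open>a\<close> cancel.\<close>
  have "z ^ n = z * z ^ (n - 1)"
    using assms by (simp add: power_eq_if)
  thus ?thesis
    by (simp add: modified_smirnov_def pderiv_monom poly_monom algebra_simps)
qed

lemma dilate_diff: "dilate R (p - q) = dilate R p - dilate R q"
  by (simp add: dilate_def pcompose_diff)

lemma coeff_dilate: "coeff (dilate R p) i = of_real R ^ i * coeff p i"
  by (simp add: dilate_def coeff_pcompose_linear)

lemma dilate_monom: "dilate R (monom c n) = smult (of_real R ^ n) (monom c n)"
  by (rule poly_eqI) (simp add: coeff_dilate)

lemma max_on_circle_monom: "max_on_circle (monom c n) = cmod c"
  using max_on_circle_attained[of "monom c n"]
  by (auto simp: poly_monom norm_mult norm_power)

section \<open>The combination of dilation and multiple, and the resulting bound\<close>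

text \<open>For \<open>R > 1\<close> the strict growth of \<open>F\<close> under dilation beats the
  factor \<open>\<gamma>\<close>. For \<open>R = 1\<close> the combination is
  \<open>(1 - \<gamma>) F\<close>, and \<open>K\<close> excludes
  \<open>\<gamma> = 1\<close>.\<close>

lemma dilate_diff_smult_nonzero:
  fixes F :: "complex poly"
  assumes "R \<ge> 1" "degree F \<ge> 1" "cmod \<gamma> \<le> ((R + 1) / 2) ^ degree F"
    and K: "of_real R ^ degree F - \<gamma> \<noteq> 0"
    and zeros: "\<And>x. cmod x \<ge> 1 \<Longrightarrow> poly F x \<noteq> 0"
    and x: "cmod x \<ge> 1"
  shows "poly (dilate R F - smult \<gamma> F) x \<noteq> 0"
proof (cases "R = 1")
  case True
  have "poly (dilate R F - smult \<gamma> F) x = (1 - \<gamma>) * poly F x"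
    using True by (simp add: poly_dilate algebra_simps)
  thus ?thesis using K True zeros[OF x] by simp
next
  case False
  have "cmod \<gamma> * cmod (poly F x) \<le> ((R + 1) / 2) ^ degree F * cmod (poly F x)"
    using assms(3) by (intro mult_right_mono) auto
  also have "\<dots> < cmod (poly F (of_real R * x))"
    using False assms by (intro norm_poly_dilate) auto
  finally have "cmod (\<gamma> * poly F x) < cmod (poly F (of_real R * x))"
    by (simp add: norm_mult)
  thus ?thesis by (auto simp: poly_dilate)
qed

lemma degree_dilate_diff_smult:
  assumes "of_real R ^ degree F - \<gamma> \<noteq> 0"
  shows "degree (dilate R F - smult \<gamma> F) = degree F"
proof (rule antisym)
  show "degree (dilate R F - smult \<gamma> F) \<le> degree F"
    by (rule degree_le) (simp add: coeff_dilate coeff_eq_0)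
  have "coeff (dilate R F - smult \<gamma> F) (degree F) = (of_real R ^ degree F - \<gamma>) * lead_coeff F"
    by (simp add: coeff_dilate algebra_simps)
  thus "degree F \<le> degree (dilate R F - smult \<gamma> F)"
    using assms by (cases "F = 0") (auto intro: le_degree)
qed

lemma modified_smirnov_dilate_diff_bound:
  fixes P :: "complex poly"
  assumes n: "degree P = n" "n \<ge> 1" and a: "cmod a \<le> 1" and R: "R \<ge> 1" and z: "cmod z \<ge> 1"
    and \<gamma>: "cmod \<gamma> \<le> ((R + 1) / 2) ^ n"
  shows "cmod (modified_smirnov n a (dilate R P) z - \<gamma> * modified_smirnov n a P z)
    \<le> cmod (of_real R ^ n - \<gamma>) * cmod (modified_smirnov n a (monom 1 n) z) * max_on_circle P"
proof (cases "of_real R ^ n - \<gamma> = 0")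
  case True
  \<comment> \<open>The bound on \<open>\<gamma>\<close> permits \<open>\<gamma> = R ^ n\<close>
    only for \<open>R = 1\<close>, where \<open>\<gamma> = 1\<close> and both sides of the claim
    vanish.\<close>
  have "R = 1"
  proof (rule ccontr)
    assume "R \<noteq> 1"
    hence "((R + 1) / 2) ^ n < R ^ n"
      using R n by (intro power_strict_mono) auto
    moreover have "cmod \<gamma> = R ^ n"
    proof -
      have "\<gamma> = of_real (R ^ n)" using True by simp
      thus ?thesis using R by (simp only: norm_of_real) simp
    qed
    ultimately show False using \<gamma> by simp
  qed
  thus ?thesis using True by (simp add: dilate_def)
next
  case K: False
  define T where "T p = modified_smirnov n a (dilate R p - smult \<gamma> p) z" for p
  have T: "T p = modified_smirnov n a (dilate R p) z - \<gamma> * modified_smirnov n a p z" for p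
    by (simp add: T_def modified_smirnov_diff modified_smirnov_smult)
  define D where "D = (of_real R ^ n - \<gamma>) * modified_smirnov n a (monom 1 n) z"
  have T_monom: "T (monom c n) = c * D" for c
    using n by (simp add: T D_def dilate_monom modified_smirnov_smult modified_smirnov_monom
        algebra_simps)
  have D0: "D \<noteq> 0"
    using K z n by (auto simp: D_def modified_smirnov_monom)
  have "cmod (T P) \<le> cmod D * max_on_circle P"
  proof (rule ccontr)
    assume contr: "\<not> cmod (T P) \<le> cmod D * max_on_circle P"
    \<comment> \<open>Chosen so that \<open>T (monom \<mu> n) = T P\<close>, hence
      \<open>T F = 0\<close> below; failure of the bound says exactly that \<open>\<mu>\<close>
      exceeds the maximum on the circle in modulus.\<close>
    define \<mu> where "\<mu> = T P / D"
    have \<mu>: "cmod \<mu> > max_on_circle P"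
      using contr D0 by (simp add: \<mu>_def norm_divide field_simps)
    define F where "F = monom \<mu> n - P"
    have degF: "degree F = n"
    proof (rule antisym)
      show "degree F \<le> n"
        unfolding F_def using n(1) by (intro degree_diff_le) (auto simp: degree_monom_le)
      have "coeff F n = \<mu> - lead_coeff P" using n(1) by (simp add: F_def)
      moreover have "\<mu> \<noteq> lead_coeff P"
        using \<mu> norm_lead_coeff_le[of P] by auto
      ultimately show "n \<le> degree F" by (intro le_degree) simp
    qed
    have F0: "poly F x \<noteq> 0" if x: "cmod x \<ge> 1" for x
    proof
      assume "poly F x = 0"
      hence "poly P x = \<mu> * x ^ n" by (simp add: F_def poly_monom)
      hence "cmod \<mu> * cmod x ^ n \<le> max_on_circle P * cmod x ^ n"
        using norm_poly_outside_disk[OF x, of P] n(1) by (simp add: norm_mult norm_power)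
      moreover have "cmod x ^ n > 0" using x by (intro zero_less_power) auto
      ultimately show False using \<mu> by simp
    qed
    have deg: "degree (dilate R F - smult \<gamma> F) = n"
      using degree_dilate_diff_smult[of R F \<gamma>] K degF by simp
    have "modified_smirnov (degree (dilate R F - smult \<gamma> F)) a (dilate R F - smult \<gamma> F) z \<noteq> 0"
      using dilate_diff_smult_nonzero[of R F \<gamma>] a z R n \<gamma> K F0 degF deg
      by (intro modified_smirnov_nonzero) auto
    hence "T F \<noteq> 0" by (simp add: T_def deg)
    moreover have "T F = T (monom \<mu> n) - T P"
      by (simp add: F_def T dilate_diff modified_smirnov_diff algebra_simps)
    ultimately show False using D0 by (simp add: T_monom \<mu>_def)
  qed
  thus ?thesis by (simp add: T D_def norm_mult)
qed

theorem theorem2p1: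
  fixes n :: nat and a \<alpha> \<beta> z :: complex and R :: real
  assumes "n \<ge> 1"
    and "cmod a \<le> 1" and "cmod \<alpha> \<le> 1" and "cmod \<beta> \<le> 1"
    and "R \<ge> 1" and "cmod z \<ge> 1"
  shows "(\<forall>P :: complex poly. degree P = n \<longrightarrow>
            cmod (modified_smirnov n a (dilate R P) z
                  - \<alpha> * modified_smirnov n a P z
                  + \<beta> * complex_of_real (((R + 1) / 2) ^ n - cmod \<alpha>) * modified_smirnov n a P z)
            \<le> cmod (complex_of_real (R ^ n) - \<alpha>
                    + \<beta> * complex_of_real (((R + 1) / 2) ^ n - cmod \<alpha>))
               * cmod (modified_smirnov n a (monom 1 n) z) * max_on_circle P)
       \<and> (\<forall>c :: complex. c \<noteq> 0 \<longrightarrow>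
            cmod (modified_smirnov n a (dilate R (monom c n)) z
                  - \<alpha> * modified_smirnov n a (monom c n) z
                  + \<beta> * complex_of_real (((R + 1) / 2) ^ n - cmod \<alpha>)
                      * modified_smirnov n a (monom c n) z)
            = cmod (complex_of_real (R ^ n) - \<alpha>
                    + \<beta> * complex_of_real (((R + 1) / 2) ^ n - cmod \<alpha>))
               * cmod (modified_smirnov n a (monom 1 n) z) * max_on_circle (monom c n))"
proof -
  \<comment> \<open>The terms with \<open>\<alpha>\<close> and \<open>\<beta>\<close> both multiply
    the undilated operator, so they merge into one coefficient; the bracket is nonnegative, and the
    summand \<open>cmod \<alpha>\<close> cancels in the triangle inequality.\<close>
  define \<gamma> where "\<gamma> = \<alpha> - \<beta> * complex_of_real (((R + 1) / 2) ^ n - cmod \<alpha>)"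
  have "1 \<le> ((R + 1) / 2) ^ n"
    using assms(5) by (intro one_le_power) auto
  hence k: "0 \<le> ((R + 1) / 2) ^ n - cmod \<alpha>"
    using assms(3) by simp
  have "cmod \<gamma> \<le> cmod \<alpha> + cmod \<beta> * (((R + 1) / 2) ^ n - cmod \<alpha>)"
    using norm_triangle_ineq4[of \<alpha> "\<beta> * complex_of_real (((R + 1) / 2) ^ n - cmod \<alpha>)"] k
    unfolding \<gamma>_def norm_mult norm_of_real by simp
  also have "\<dots> \<le> cmod \<alpha> + (((R + 1) / 2) ^ n - cmod \<alpha>)"
    using mult_left_le_one_le[OF k norm_ge_zero assms(4)] by simp
  finally have \<gamma>: "cmod \<gamma> \<le> ((R + 1) / 2) ^ n" by simp
  have comb: "u - \<alpha> * v + \<beta> * complex_of_real (((R + 1) / 2) ^ n - cmod \<alpha>) * v = u - \<gamma> * v"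
    for u v by (simp add: \<gamma>_def algebra_simps)
  have coef: "complex_of_real (R ^ n) - \<alpha> + \<beta> * complex_of_real (((R + 1) / 2) ^ n - cmod \<alpha>)
      = of_real R ^ n - \<gamma>"
    by (simp add: \<gamma>_def)
  show ?thesis
    unfolding comb coef
  proof (intro conjI allI impI)
    fix P :: "complex poly" assume "degree P = n"
    with assms \<gamma> show "cmod (modified_smirnov n a (dilate R P) z - \<gamma> * modified_smirnov n a P z)
      \<le> cmod (of_real R ^ n - \<gamma>) * cmod (modified_smirnov n a (monom 1 n) z) * max_on_circle P"
      by (intro modified_smirnov_dilate_diff_bound) auto
  next
    fix c :: complex
    have "modified_smirnov n a (dilate R (monom c n)) z - \<gamma> * modified_smirnov n a (monom c n) z
      = (of_real R ^ n - \<gamma>) * modified_smirnov n a (monom 1 n) z * c"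
      using assms(1)
      by (simp add: dilate_monom modified_smirnov_smult modified_smirnov_monom algebra_simps)
    thus "cmod (modified_smirnov n a (dilate R (monom c n)) z - \<gamma> * modified_smirnov n a (monom c n) z)
      = cmod (of_real R ^ n - \<gamma>) * cmod (modified_smirnov n a (monom 1 n) z)
        * max_on_circle (monom c n)"
      by (simp add: norm_mult max_on_circle_monom)
  qed
qed

end
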